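(* Let $\Delta$ be a simplicial complex on $[n]$ and let $\mathbf b\in 2^{[n]}\setminus\Delta$ be a nonface. Then \[ \dim_{\mathbb K}T^1_{-\mathbf b}(\Delta)= \begin{cases} 1 & \text{if } \Delta\cong(\Delta\setminus\mathbf b)*\partial\mathbf b \text{ and } \#\mathbf b>1,\\ 0 & \text{otherwise.} \end{cases} \]
   Context: Let $n\geq 1$ and $[n]=\{1,\dots,n\}$. A simplicial complex on a finite set $E$ is a family $\Delta\subseteq 2^E$ closed under taking subsets. For $\mathbf b\subseteq[n]$, the deletion $\Delta\setminus\mathbf b=\{F\in\Delta : F\cap\mathbf b=\emptyset\}$ is a simplicial complex on $[n]\setminus\mathbf b$, and $\partial\mathbf b=\{A : A\subsetneq\mathbf b\}$ is a simplicial complex on $\mathbf b$. The join of complexes on disjoint ground sets is $\Delta*\Gamma=\{F\sqcup G : F\in\Delta,\ G\in\Gamma\}$, on the disjoint union of the ground sets. $\cong$ denotes isomorphism of simplicial complexes (induced by a bijection of ground sets). A subset $\mathbf b\subseteq[n]$ is identified with its indicator vector in $\{0,1\}^n$, and $\#\mathbf b$ is its cardinality. Let $\mathbb K$ be a field and $S=\mathbb K[x_1,\dots,x_n]$ with its standard $\mathbb Z^n$-grading. The Stanley-Reisner ideal is $I_\Delta=\langle \prod_{i\in F}x_i : F\in 2^{[n]}\setminus\Delta\rangle$. The first cotangent cohomology module $T^1(\Delta)=T^1(S/I_\Delta)$ is the cokernel of the natural map $\operatorname{Der}_{\mathbb K}(S,S)\to\operatorname{Hom}_S(I_\Delta,S/I_\Delta)$,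 sending a $\mathbb K$-linear derivation $\partial$ to $f\mapsto\partial(f)\bmod I_\Delta$. It is $\mathbb Z^n$-graded, and $T^1_{\mathbf c}(\Delta)$ denotes its component of degree $\mathbf c\in\mathbb Z^n$.
   Formalization: The complex Δ is assumed to be a nonempty family (so the empty set is a face); for the void complex Δ = {} and #b > 1 the formula fails, since T^1 = 0 while Δ ≅ (Δ∖b)*∂b. *)

theory Defs
  imports "Jordan_Normal_Form.VS_Connect" "HOL-Algebra.Ideal" "HOL-Library.Poly_Mapping" "HOL-Library.Indicator_Function"
begin

section \<open>Simplicial complexes\<close>

text \<open>The ground set may have elements that are not vertices, and \<open>\<Delta>\<close> may be empty (the void complex,
  as opposed to \<open>{{}}\<close>).\<close>
definition simplicial_complex :: "'v set \<Rightarrow> 'v set set \<Rightarrow> bool" where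
  "simplicial_complex E \<Delta> \<longleftrightarrow> finite E \<and> \<Delta> \<subseteq> Pow E \<and> (\<forall>F\<in>\<Delta>. \<forall>G. G \<subseteq> F \<longrightarrow> G \<in> \<Delta>)"

definition deletion :: "'v set set \<Rightarrow> 'v set \<Rightarrow> 'v set set" where
  "deletion \<Delta> b = {F \<in> \<Delta>. F \<inter> b = {}}"

definition simplex_boundary :: "'v set \<Rightarrow> 'v set set" where
  "simplex_boundary b = {A. A \<subset> b}"

text \<open>Only meaningful for complexes on disjoint ground sets \<open>E\<close> and \<open>E'\<close>; the result is a complex
  on \<open>E \<union> E'\<close>.\<close>
definition complex_join :: "'v set set \<Rightarrow> 'v set set \<Rightarrow> 'v set set" where
  "complex_join \<Delta> \<Gamma> = {F \<union> G |F G. F \<in> \<Delta> \<and> G \<in> \<Gamma>}"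

definition complex_iso :: "'v set \<Rightarrow> 'v set set \<Rightarrow> 'w set \<Rightarrow> 'w set set \<Rightarrow> bool" where
  "complex_iso E \<Delta> E' \<Delta>' \<longleftrightarrow> (\<exists>f. bij_betw f E E' \<and> (\<lambda>F. f ` F) ` \<Delta> = \<Delta>')"

section \<open>Modules and vector spaces\<close>

text \<open>The multiplicative fields of the record type of modules play no role for modules that are not
  rings and are left unspecified.\<close>

definition regular_module :: "('a, 'm) ring_scheme \<Rightarrow> ('a, 'a) module" where
  "regular_module R = \<lparr>carrier = carrier R, mult = mult R, one = one R, zero = zero R,
     add = add R, smult = mult R\<rparr>"

definition quotient_module :: "('a, 'b, 'm) module_scheme \<Rightarrow> 'b set \<Rightarrow> ('a, 'b set) module" where
  "quotient_module M N = \<lparr>carrier = a_rcosets\<^bsub>M\<^esub> N, mult = undefined, one = undefined,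
     zero = N, add = set_add M,
     smult = (\<lambda>a X. \<Union>x\<in>X. N +>\<^bsub>M\<^esub> (a \<odot>\<^bsub>M\<^esub> x))\<rparr>"

text \<open>Homomorphisms are extensional, i.e.\ \<open>undefined\<close> outside the carrier of \<open>M\<close>, so that distinct
  elements of the module differ as maps on \<open>M\<close>.\<close>
definition Hom_module ::
  "('a, 'r) ring_scheme \<Rightarrow> ('a, 'b, 'm) module_scheme \<Rightarrow> ('a, 'c, 'n) module_scheme
    \<Rightarrow> ('a, 'b \<Rightarrow> 'c) module" where
  "Hom_module R M N = \<lparr>carrier = LinearCombinations.module_hom R M N \<inter> extensional (carrier M),
     mult = undefined, one = undefined,
     zero = (\<lambda>x\<in>carrier M. \<zero>\<^bsub>N\<^esub>),
     add = (\<lambda>\<phi> \<psi>. \<lambda>x\<in>carrier M. \<phi> x \<oplus>\<^bsub>N\<^esub> \<psi> x),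
     smult = (\<lambda>a \<phi>. \<lambda>x\<in>carrier M. a \<odot>\<^bsub>N\<^esub> \<phi> x)\<rparr>"

text \<open>\<open>vectorspace.dim\<close> is a natural number with no useful value in infinite dimension, so finite
  dimensionality is part of the notion.\<close>
definition has_dimension :: "('a, 'r) ring_scheme \<Rightarrow> ('a, 'b, 'm) module_scheme \<Rightarrow> nat \<Rightarrow> bool" where
  "has_dimension K V d \<longleftrightarrow> vectorspace K V \<and> vectorspace.fin_dim K V \<and> vectorspace.dim K V = d"

section \<open>The polynomial ring and Stanley-Reisner ideals\<close>

text \<open>Exponent vectors are finitely supported functions \<open>'n \<Rightarrow>\<^sub>0 nat\<close>, and multiplication of
  \<open>poly_mapping\<close> is convolution, so this type is the polynomial ring over \<open>'k\<close> with variables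
  indexed by \<open>'n\<close>.\<close>
type_synonym ('n, 'k) mpoly = "('n \<Rightarrow>\<^sub>0 nat) \<Rightarrow>\<^sub>0 'k"

definition Var :: "'n \<Rightarrow> ('n, 'k::field) mpoly" where
  "Var i = Poly_Mapping.single (Poly_Mapping.single i 1) 1"

definition Const :: "'k \<Rightarrow> ('n, 'k::field) mpoly" where
  "Const c = Poly_Mapping.single 0 c"

abbreviation S_ring :: "('n, 'k::field) mpoly ring" where
  "S_ring \<equiv> class_ring"

definition homogeneous_part :: "('n \<Rightarrow> int) \<Rightarrow> ('n, 'k::field) mpoly set" where
  "homogeneous_part a =
     {f. \<forall>m\<in>Poly_Mapping.keys f. \<forall>i. int (Poly_Mapping.lookup m i) = a i}"

definition stanley_reisner_ideal :: "'n::finite set set \<Rightarrow> ('n, 'k::field) mpoly set" where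
  "stanley_reisner_ideal \<Delta> = Idl\<^bsub>S_ring\<^esub> {\<Prod>i\<in>F. Var i |F. F \<notin> \<Delta>}"

section \<open>First cotangent cohomology\<close>

definition derivations :: "(('n, 'k::field) mpoly \<Rightarrow> ('n, 'k) mpoly) set" where
  "derivations = {d. (\<forall>f g. d (f + g) = d f + d g) \<and> (\<forall>c f. d (Const c * f) = Const c * d f) \<and>
     (\<forall>f g. d (f * g) = f * d g + g * d f)}"

abbreviation ideal_module :: "('n, 'k::field) mpoly set \<Rightarrow> (('n, 'k) mpoly, ('n, 'k) mpoly) module"
  where "ideal_module I \<equiv> (regular_module S_ring)\<lparr>carrier := I\<rparr>"

abbreviation residue_module ::
  "('n, 'k::field) mpoly set \<Rightarrow> (('n, 'k) mpoly, ('n, 'k) mpoly set) module"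
  where "residue_module I \<equiv> quotient_module (regular_module S_ring) I"

text \<open>\<open>Hom\<^sub>S(I, S/I)\<close>.\<close>
definition normal_module ::
  "('n, 'k::field) mpoly set \<Rightarrow> (('n, 'k) mpoly, ('n, 'k) mpoly \<Rightarrow> ('n, 'k) mpoly set) module" where
  "normal_module I = Hom_module S_ring (ideal_module I) (residue_module I)"

definition derivation_hom ::
  "('n, 'k::field) mpoly set \<Rightarrow> (('n, 'k) mpoly \<Rightarrow> ('n, 'k) mpoly) \<Rightarrow>
    ('n, 'k) mpoly \<Rightarrow> ('n, 'k) mpoly set" where
  "derivation_hom I d = (\<lambda>f\<in>I. I +>\<^bsub>S_ring\<^esub> d f)"

text \<open>The cokernel of \<open>Der(S, S) \<rightarrow> Hom\<^sub>S(I, S/I)\<close>.\<close>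
definition T1 ::
  "('n, 'k::field) mpoly set \<Rightarrow>
    (('n, 'k) mpoly, (('n, 'k) mpoly \<Rightarrow> ('n, 'k) mpoly set) set) module" where
  "T1 I = quotient_module (normal_module I) (derivation_hom I ` derivations)"

text \<open>The component of degree \<open>c\<close> of \<open>Hom\<^sub>S(I, S/I)\<close>: homomorphisms that shift the
  \<open>\<int>\<^sup>n\<close>-degree by \<open>c\<close>.\<close>
definition normal_component ::
  "('n, 'k::field) mpoly set \<Rightarrow> ('n \<Rightarrow> int) \<Rightarrow> (('n, 'k) mpoly \<Rightarrow> ('n, 'k) mpoly set) set" where
  "normal_component I c = {\<phi> \<in> carrier (normal_module I).
     \<forall>a. \<forall>f \<in> I \<inter> homogeneous_part a.
       \<phi> f \<in> (\<lambda>g. I +>\<^bsub>S_ring\<^esub> g) ` homogeneous_part (\<lambda>i. a i + c i)}"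

text \<open>The component of degree \<open>c\<close> of \<open>T\<^sup>1(S/I)\<close>, i.e.\ the image of the degree \<open>c\<close> component of
  \<open>Hom\<^sub>S(I, S/I)\<close>, with scalars restricted from \<open>S\<close> to the constants.\<close>
definition T1_component ::
  "('n, 'k::field) mpoly set \<Rightarrow> ('n \<Rightarrow> int) \<Rightarrow>
    ('k, (('n, 'k) mpoly \<Rightarrow> ('n, 'k) mpoly set) set) module" where
  "T1_component I c = \<lparr>carrier =
       (\<lambda>\<phi>. (derivation_hom I ` derivations) +>\<^bsub>normal_module I\<^esub> \<phi>) ` normal_component I c,
     mult = undefined, one = undefined, zero = zero (T1 I), add = add (T1 I),
     smult = (\<lambda>k. smult (T1 I) (Const k))\<rparr>"

end

theory Submission
  imports Defs
begin

text \<open>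
  Write \<open>I\<close> for the Stanley-Reisner ideal. It is spanned by the monomials whose support is a
  nonface (\<open>stanley_reisner_ideal_eq\<close>), so homomorphisms out of \<open>I\<close> can be studied monomial by
  monomial. A homomorphism \<open>\<phi>\<close> of degree \<open>-b\<close> sends the squarefree monomial \<open>x^b\<close>, which lies in
  \<open>I\<close> because \<open>b\<close> is a nonface, to a constant \<open>k\<close>. This constant determines \<open>\<phi>\<close>: a multiple
  \<open>x^q x^b\<close> must go to \<open>k x^q\<close>, and a monomial that \<open>x^b\<close> does not divide goes to 0, since its image
  would have an exponent vector with a negative entry. In other words \<open>\<phi>\<close> is \<open>k\<close> times the
  contraction by \<open>x^b\<close>, which divides the monomials divisible by \<open>x^b\<close> by it and kills all others
  (\<open>normal_component_scalar\<close>).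

  The contraction induces an \<open>S\<close>-linear map \<open>I \<rightarrow> S/I\<close> exactly when every \<open>F\<close> with \<open>F - b \<in> \<Delta>\<close>
  and \<open>\<not> b \<subseteq> F\<close> is a face. If some such \<open>F\<close> is a nonface, then \<open>x^F\<close> is in \<open>I\<close> and is sent to 0,
  while its multiple with support \<open>b \<union> F\<close> is sent to \<open>k x^(F - b)\<close>, which is nonzero modulo \<open>I\<close>
  unless \<open>k = 0\<close>; so the whole component vanishes (\<open>normal_component_nonsplit\<close>). If there is no
  such \<open>F\<close>, the comparison of the two sides of linearity on monomials shows that their difference is
  in \<open>I\<close> (\<open>contract_linear_mod_ideal\<close>), and the component is the line spanned by the contraction
  (\<open>normal_component_split\<close>).

  The condition on \<open>F\<close> says that \<open>\<Delta>\<close> equals \<open>(\<Delta> \<setminus> b) * \<partial>b\<close>. As \<open>b\<close> is a nonface, \<open>\<Delta>\<close> is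
  always contained in this join; an abstract isomorphism makes the two finite complexes equally large,
  hence equal (\<open>complex_iso_join_iff\<close>).

  It remains to see when the contraction comes from a derivation. If \<open>b = {i}\<close>, then \<open>x\<^sub>i\<close> itself
  lies in \<open>I\<close>, and modulo \<open>I\<close> the contraction agrees with \<open>\<partial>/\<partial>x\<^sub>i\<close>: the two differ only
  on monomials divisible by \<open>x\<^sub>i\<^sup>2\<close>, and there both values are in \<open>I\<close>
  (\<open>contract_singleton_eq_derivation\<close>). If \<open>b\<close> has at least two elements, then by the product rule no
  derivation maps \<open>x^b\<close> to a polynomial with a nonzero constant term, whereas the contraction maps it
  to 1 (\<open>contract_not_derivation\<close>).
\<close>

section \<open>Quotient modules and modules of homomorphisms\<close>

lemma quotient_module_carrier:
  "carrier (quotient_module M N) = (\<lambda>x. N +>\<^bsub>M\<^esub> x) ` carrier M"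
  by (auto simp: quotient_module_def A_RCOSETS_def')

lemma submodule_abelian_subgroup:
  assumes "Module.module R M" "Module.submodule N R M"
  shows "abelian_subgroup N M"
  using assms by (intro abelian_subgroupI3 additive_subgroupI)
    (auto simp: Module.submodule_def Module.module_def)

lemma quotient_module_add:
  assumes "Module.module R M" "Module.submodule N R M" "x \<in> carrier M" "y \<in> carrier M"
  shows "(N +>\<^bsub>M\<^esub> x) \<oplus>\<^bsub>quotient_module M N\<^esub> (N +>\<^bsub>M\<^esub> y) = N +>\<^bsub>M\<^esub> (x \<oplus>\<^bsub>M\<^esub> y)"
  using abelian_subgroup.a_rcos_sum[OF submodule_abelian_subgroup] assms
  by (simp add: quotient_module_def)

text \<open>The union that defines scalar multiplication of cosets is a union of equal cosets: two representatives
  differ by an element of \<open>N\<close>, and \<open>N\<close> is closed under scalars.\<close>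
lemma quotient_module_smult:
  assumes M: "Module.module R M" and N: "Module.submodule N R M"
    and x: "x \<in> carrier M" and a: "a \<in> carrier R"
  shows "a \<odot>\<^bsub>quotient_module M N\<^esub> (N +>\<^bsub>M\<^esub> x) = N +>\<^bsub>M\<^esub> (a \<odot>\<^bsub>M\<^esub> x)"
proof -
  interpret M: Module.module R M by fact
  interpret N: abelian_subgroup N M by (rule submodule_abelian_subgroup) fact+
  have eq: "N +>\<^bsub>M\<^esub> (a \<odot>\<^bsub>M\<^esub> y) = N +>\<^bsub>M\<^esub> (a \<odot>\<^bsub>M\<^esub> x)" if y: "y \<in> N +>\<^bsub>M\<^esub> x" for y
  proof -
    obtain h where h: "h \<in> N" "y = h \<oplus>\<^bsub>M\<^esub> x" using y by (auto simp: a_r_coset_def')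
    have hM: "h \<in> carrier M" using h N.a_subset by auto
    have "a \<odot>\<^bsub>M\<^esub> y = a \<odot>\<^bsub>M\<^esub> h \<oplus>\<^bsub>M\<^esub> a \<odot>\<^bsub>M\<^esub> x"
      using h(2) hM x a by (simp add: M.smult_r_distr)
    moreover have "a \<odot>\<^bsub>M\<^esub> h \<in> N" using Module.submodule.smult_closed[OF N a h(1)] .
    ultimately have "a \<odot>\<^bsub>M\<^esub> y \<in> N +>\<^bsub>M\<^esub> (a \<odot>\<^bsub>M\<^esub> x)" by (auto simp: a_r_coset_def')
    then show ?thesis
      using M.a_repr_independence[OF _ M.smult_closed[OF a x] N.a_subgroup] by simp
  qed
  have "(\<Union>y\<in>N +>\<^bsub>M\<^esub> x. N +>\<^bsub>M\<^esub> (a \<odot>\<^bsub>M\<^esub> y)) = (\<Union>y\<in>N +>\<^bsub>M\<^esub> x. N +>\<^bsub>M\<^esub> (a \<odot>\<^bsub>M\<^esub> x))"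
    using eq by (intro SUP_cong refl)
  also have "\<dots> = N +>\<^bsub>M\<^esub> (a \<odot>\<^bsub>M\<^esub> x)"
    using N.a_rcos_self[OF x] by blast
  finally show ?thesis by (simp add: quotient_module_def)
qed

lemma coset_eq_submodule_iff:
  assumes "Module.module R M" "Module.submodule N R M" "x \<in> carrier M"
  shows "N +>\<^bsub>M\<^esub> x = N \<longleftrightarrow> x \<in> N"
proof -
  interpret M: Module.module R M by fact
  interpret N: abelian_subgroup N M by (rule submodule_abelian_subgroup) fact+
  show ?thesis
    using M.a_coset_join1[OF _ assms(3) N.a_subgroup] M.a_coset_join2[OF assms(3) N.a_subgroup] by blast
qed

lemma module_quotient_module:
  assumes M: "Module.module R M" and N: "Module.submodule N R M"
  shows "Module.module R (quotient_module M N)"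
proof -
  interpret M: Module.module R M by fact
  interpret N: abelian_subgroup N M by (rule submodule_abelian_subgroup) fact+
  let ?Q = "quotient_module M N"
  note q = quotient_module_carrier quotient_module_add[OF M N] quotient_module_smult[OF M N]
  have zero: "\<zero>\<^bsub>?Q\<^esub> = N +>\<^bsub>M\<^esub> \<zero>\<^bsub>M\<^esub>"
    by (simp add: quotient_module_def M.a_coset_add_zero N.a_subset)
  have "abelian_group ?Q"
  proof (rule abelian_groupI)
    fix X assume "X \<in> carrier ?Q"
    then obtain x where x: "x \<in> carrier M" "X = N +>\<^bsub>M\<^esub> x" by (auto simp: q)
    then show "\<exists>Y \<in> carrier ?Q. Y \<oplus>\<^bsub>?Q\<^esub> X = \<zero>\<^bsub>?Q\<^esub>"
      by (intro bexI[of _ "N +>\<^bsub>M\<^esub> (\<ominus>\<^bsub>M\<^esub> x)"]) (auto simp: q zero M.M.l_neg)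
  qed (auto simp: q zero M.M.a_ac)
  then show ?thesis
    by (rule moduleI[OF M.R.is_cring])
      (auto simp: q M.smult_l_distr M.smult_r_distr M.smult_assoc1)
qed

lemma Hom_module_carrier:
  "\<phi> \<in> carrier (Hom_module R M N) \<longleftrightarrow>
    \<phi> \<in> extensional (carrier M) \<and> \<phi> \<in> carrier M \<rightarrow> carrier N \<and>
    (\<forall>x\<in>carrier M. \<forall>y\<in>carrier M. \<phi> (x \<oplus>\<^bsub>M\<^esub> y) = \<phi> x \<oplus>\<^bsub>N\<^esub> \<phi> y) \<and>
    (\<forall>a\<in>carrier R. \<forall>x\<in>carrier M. \<phi> (a \<odot>\<^bsub>M\<^esub> x) = a \<odot>\<^bsub>N\<^esub> \<phi> x)"
  by (auto simp: Hom_module_def LinearCombinations.module_hom_def)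

text \<open>All operations are pointwise, so each module law is inherited from the values in \<open>N\<close>; commutativity
  of \<open>R\<close> enters in that scalar multiples of linear maps are linear.\<close>
lemma module_Hom_module:
  assumes M: "Module.module R M" and N: "Module.module R N"
  shows "Module.module R (Hom_module R M N)"
proof -
  interpret M: Module.module R M by fact
  interpret N: Module.module R N by fact
  let ?H = "Hom_module R M N"
  have ops: "\<zero>\<^bsub>?H\<^esub> = (\<lambda>x\<in>carrier M. \<zero>\<^bsub>N\<^esub>)"
    "\<And>\<phi> \<psi>. \<phi> \<oplus>\<^bsub>?H\<^esub> \<psi> = (\<lambda>x\<in>carrier M. \<phi> x \<oplus>\<^bsub>N\<^esub> \<psi> x)"
    "\<And>a \<phi>. a \<odot>\<^bsub>?H\<^esub> \<phi> = (\<lambda>x\<in>carrier M. a \<odot>\<^bsub>N\<^esub> \<phi> x)"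
    by (simp_all add: Hom_module_def)
  have val: "\<phi> x \<in> carrier N" if "\<phi> \<in> carrier ?H" "x \<in> carrier M" for \<phi> x
    using that by (auto simp: Hom_module_carrier)
  have add: "\<phi> \<oplus>\<^bsub>?H\<^esub> \<psi> \<in> carrier ?H" if "\<phi> \<in> carrier ?H" "\<psi> \<in> carrier ?H" for \<phi> \<psi>
    using that unfolding Hom_module_carrier ops
    by (auto simp: Pi_iff N.smult_r_distr N.M.a_ac)
  have smult: "a \<odot>\<^bsub>?H\<^esub> \<phi> \<in> carrier ?H" if "a \<in> carrier R" "\<phi> \<in> carrier ?H" for a \<phi>
    using that unfolding Hom_module_carrier ops
    by (auto simp: Pi_iff N.smult_r_distr N.smult_assoc1[symmetric] M.R.m_comm)
  have zero: "\<zero>\<^bsub>?H\<^esub> \<in> carrier ?H"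
    unfolding Hom_module_carrier ops by auto
  have eqI: "\<phi> = \<psi>" if "\<phi> \<in> carrier ?H" "\<psi> \<in> carrier ?H"
    "\<And>x. x \<in> carrier M \<Longrightarrow> \<phi> x = \<psi> x" for \<phi> \<psi>
    using that by (intro extensionalityI[of _ "carrier M"]) (simp_all add: Hom_module_carrier)
  have "abelian_group ?H"
  proof (rule abelian_groupI)
    fix \<phi> assume \<phi>: "\<phi> \<in> carrier ?H"
    have m1: "\<ominus>\<^bsub>R\<^esub> \<one>\<^bsub>R\<^esub> \<in> carrier R" by simp
    have "(\<ominus>\<^bsub>R\<^esub> \<one>\<^bsub>R\<^esub>) \<odot>\<^bsub>?H\<^esub> \<phi> \<oplus>\<^bsub>?H\<^esub> \<phi> = \<zero>\<^bsub>?H\<^esub>"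
      by (rule eqI[OF add[OF smult[OF m1 \<phi>] \<phi>] zero])
        (simp add: ops val[OF \<phi>] N.smult_l_minus N.M.l_neg)
    then show "\<exists>\<psi> \<in> carrier ?H. \<psi> \<oplus>\<^bsub>?H\<^esub> \<phi> = \<zero>\<^bsub>?H\<^esub>"
      using smult[OF m1 \<phi>] by blast
    show "\<zero>\<^bsub>?H\<^esub> \<oplus>\<^bsub>?H\<^esub> \<phi> = \<phi>"
      by (rule eqI[OF add[OF zero \<phi>] \<phi>]) (simp add: ops val[OF \<phi>])
    fix \<psi> assume \<psi>: "\<psi> \<in> carrier ?H"
    show "\<phi> \<oplus>\<^bsub>?H\<^esub> \<psi> \<in> carrier ?H" using \<phi> \<psi> by (rule add)
    show "\<phi> \<oplus>\<^bsub>?H\<^esub> \<psi> = \<psi> \<oplus>\<^bsub>?H\<^esub> \<phi>"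
      by (rule eqI[OF add[OF \<phi> \<psi>] add[OF \<psi> \<phi>]])
        (simp add: ops val[OF \<phi>] val[OF \<psi>] N.M.a_comm)
    fix \<chi> assume \<chi>: "\<chi> \<in> carrier ?H"
    show "(\<phi> \<oplus>\<^bsub>?H\<^esub> \<psi>) \<oplus>\<^bsub>?H\<^esub> \<chi> = \<phi> \<oplus>\<^bsub>?H\<^esub> (\<psi> \<oplus>\<^bsub>?H\<^esub> \<chi>)"
      by (rule eqI[OF add[OF add[OF \<phi> \<psi>] \<chi>] add[OF \<phi> add[OF \<psi> \<chi>]]])
        (simp add: ops val[OF \<phi>] val[OF \<psi>] val[OF \<chi>] N.M.a_assoc)
  qed (rule zero)
  then show ?thesis
  proof (rule moduleI[OF M.R.is_cring])
    fix a \<phi> assume a: "a \<in> carrier R" and \<phi>: "\<phi> \<in> carrier ?H"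
    show "a \<odot>\<^bsub>?H\<^esub> \<phi> \<in> carrier ?H" using a \<phi> by (rule smult)
    fix b assume b: "b \<in> carrier R"
    show "(a \<oplus>\<^bsub>R\<^esub> b) \<odot>\<^bsub>?H\<^esub> \<phi> = a \<odot>\<^bsub>?H\<^esub> \<phi> \<oplus>\<^bsub>?H\<^esub> b \<odot>\<^bsub>?H\<^esub> \<phi>"
      by (rule eqI[OF smult[OF M.R.a_closed[OF a b] \<phi>] add[OF smult[OF a \<phi>] smult[OF b \<phi>]]])
        (simp add: ops val[OF \<phi>] a b N.smult_l_distr)
    show "(a \<otimes>\<^bsub>R\<^esub> b) \<odot>\<^bsub>?H\<^esub> \<phi> = a \<odot>\<^bsub>?H\<^esub> (b \<odot>\<^bsub>?H\<^esub> \<phi>)"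
      by (rule eqI[OF smult[OF M.R.m_closed[OF a b] \<phi>] smult[OF a smult[OF b \<phi>]]])
        (simp add: ops val[OF \<phi>] a b N.smult_assoc1)
  next
    fix a \<phi> \<psi> assume a: "a \<in> carrier R" and \<phi>: "\<phi> \<in> carrier ?H" and \<psi>: "\<psi> \<in> carrier ?H"
    show "a \<odot>\<^bsub>?H\<^esub> (\<phi> \<oplus>\<^bsub>?H\<^esub> \<psi>) = a \<odot>\<^bsub>?H\<^esub> \<phi> \<oplus>\<^bsub>?H\<^esub> a \<odot>\<^bsub>?H\<^esub> \<psi>"
      by (rule eqI[OF smult[OF a add[OF \<phi> \<psi>]] add[OF smult[OF a \<phi>] smult[OF a \<psi>]]])
        (simp add: ops val[OF \<phi>] val[OF \<psi>] a N.smult_r_distr)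
  next
    fix \<phi> assume \<phi>: "\<phi> \<in> carrier ?H"
    show "\<one>\<^bsub>R\<^esub> \<odot>\<^bsub>?H\<^esub> \<phi> = \<phi>"
      by (rule eqI[OF smult[OF M.R.one_closed \<phi>] \<phi>]) (simp add: ops val[OF \<phi>])
  qed
qed

lemma module_regular_module: "cring R \<Longrightarrow> Module.module R (regular_module R)"
proof -
  assume "cring R"
  then interpret cring R .
  have "abelian_group (regular_module R)"
  proof (rule abelian_groupI)
    fix x assume "x \<in> carrier (regular_module R)"
    then show "\<exists>y \<in> carrier (regular_module R). y \<oplus>\<^bsub>regular_module R\<^esub> x = \<zero>\<^bsub>regular_module R\<^esub>"
      by (intro bexI[of _ "\<ominus>\<^bsub>R\<^esub> x"]) (auto simp: regular_module_def l_neg)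
  qed (auto simp: regular_module_def a_ac)
  then show ?thesis
    by (intro moduleI \<open>cring R\<close>) (auto simp: regular_module_def l_distr r_distr m_assoc)
qed

lemma a_r_coset_regular_module: "a_r_coset (regular_module R) = a_r_coset R"
  by (intro ext) (simp add: a_r_coset_def' regular_module_def)

lemma submodule_regular_module:
  assumes "ideal I R" "cring R"
  shows "Module.submodule I R (regular_module R)"
proof -
  interpret R: cring R by fact
  interpret I: ideal I R by fact
  interpret M: Module.module R "regular_module R" by (rule module_regular_module) fact
  show ?thesis
  proof (rule M.submoduleI)
    fix x assume x: "x \<in> I"
    then have xR: "x \<in> carrier (regular_module R)" by (simp add: regular_module_def I.Icarr)
    have "(\<ominus>\<^bsub>R\<^esub> \<one>\<^bsub>R\<^esub>) \<otimes>\<^bsub>R\<^esub> x \<in> I" using x by (simp add: I.I_l_closed)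
    moreover have "(\<ominus>\<^bsub>R\<^esub> \<one>\<^bsub>R\<^esub>) \<otimes>\<^bsub>R\<^esub> x = \<ominus>\<^bsub>regular_module R\<^esub> x"
      using M.smult_l_minus[OF R.one_closed xR] M.smult_one[OF xR]
      by (simp add: regular_module_def)
    ultimately show "\<ominus>\<^bsub>regular_module R\<^esub> x \<in> I" by simp
  qed (auto simp: regular_module_def I.Icarr I.I_l_closed)
qed

section \<open>Vector spaces of scalar multiples of one vector\<close>

text \<open>Scalars are restricted along \<open>h\<close>. The map \<open>k \<mapsto> h k \<odot> v\<close> from the field onto \<open>V\<close> preserves all
  operations, so the vector space laws of \<open>V\<close> come from those of the field, and over a field it is
  either zero or injective.\<close>
lemma has_dimension_multiples:
  fixes V :: "('k::field, 'b, 'n) module_scheme"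
  assumes M: "Module.module R M" and h: "h \<in> Ring.ring_hom class_ring R" and v: "v \<in> carrier M"
    and carrier: "carrier V = range (\<lambda>k. h k \<odot>\<^bsub>M\<^esub> v)"
    and zero: "\<zero>\<^bsub>V\<^esub> = \<zero>\<^bsub>M\<^esub>" and add: "add V = add M"
    and smult: "\<And>k x. k \<odot>\<^bsub>V\<^esub> x = h k \<odot>\<^bsub>M\<^esub> x"
  shows "has_dimension class_ring V (if v = \<zero>\<^bsub>M\<^esub> then 0 else 1)"
proof -
  interpret M: Module.module R M by fact
  have hR: "h k \<in> carrier R" for k using Ring.ring_hom_closed[OF h] by simp
  have h_add: "h (k + l) = h k \<oplus>\<^bsub>R\<^esub> h l" for k l using Ring.ring_hom_add[OF h, of k l] by simp
  have h_mult: "h (k * l) = h k \<otimes>\<^bsub>R\<^esub> h l" for k l using Ring.ring_hom_mult[OF h, of k l] by simp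
  have h_one: "h 1 = \<one>\<^bsub>R\<^esub>" using Ring.ring_hom_one[OF h] by simp
  have h_zero: "h 0 = \<zero>\<^bsub>R\<^esub>" using h_add[of 0 0] hR[of 0] by (simp add: M.R.add.l_cancel_one)
  have zero_eq: "\<zero>\<^bsub>V\<^esub> = h 0 \<odot>\<^bsub>M\<^esub> v" using v by (simp add: zero h_zero)
  have add_eq: "(h k \<odot>\<^bsub>M\<^esub> v) \<oplus>\<^bsub>V\<^esub> (h l \<odot>\<^bsub>M\<^esub> v) = h (k + l) \<odot>\<^bsub>M\<^esub> v" for k l
    using v hR by (simp add: add h_add M.smult_l_distr)
  have smult_eq: "k \<odot>\<^bsub>V\<^esub> (h l \<odot>\<^bsub>M\<^esub> v) = h (k * l) \<odot>\<^bsub>M\<^esub> v" for k l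
    using v hR by (simp add: smult h_mult M.smult_assoc1)
  have mem: "h k \<odot>\<^bsub>M\<^esub> v \<in> carrier V" for k by (simp add: carrier)
  have "abelian_group V"
  proof (rule abelian_groupI)
    fix x assume "x \<in> carrier V"
    then obtain k where "x = h k \<odot>\<^bsub>M\<^esub> v" by (auto simp: carrier)
    then have "(h (- k) \<odot>\<^bsub>M\<^esub> v) \<oplus>\<^bsub>V\<^esub> x = \<zero>\<^bsub>V\<^esub>" by (simp add: add_eq zero_eq)
    then show "\<exists>y \<in> carrier V. y \<oplus>\<^bsub>V\<^esub> x = \<zero>\<^bsub>V\<^esub>" using mem by blast
  qed (auto simp: carrier add_eq zero_eq algebra_simps)
  then have "Module.module (class_ring :: 'k ring) V"
    by (rule moduleI[OF class_cring.is_cring])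
      (auto simp: carrier add_eq smult_eq algebra_simps)
  then have vs: "vectorspace (class_ring :: 'k ring) V"
    by (intro vectorspace.intro class_field)
  interpret V: vectorspace "class_ring :: 'k ring" V by fact
  show ?thesis
  proof (cases "v = \<zero>\<^bsub>M\<^esub>")
    case True
    then have "carrier V = {\<zero>\<^bsub>V\<^esub>}" using hR by (simp add: carrier zero image_constant_conv)
    then have basis: "V.basis {}"
      unfolding V.basis_def by (auto simp: V.span_empty V.lin_dep_def)
    then have "V.fin_dim" unfolding V.fin_dim_def V.basis_def by blast
    with V.dim_basis[OF _ basis] vs True show ?thesis by (simp add: has_dimension_def)
  next
    case False
    have v_eq: "h 1 \<odot>\<^bsub>M\<^esub> v = v" using v by (simp add: h_one)
    have vV: "v \<in> carrier V" using mem[of 1] v_eq by simp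
    have "V.span {v} = carrier V"
    proof
      show "V.span {v} \<subseteq> carrier V" using vV by (intro V.span_is_subset2) auto
      show "carrier V \<subseteq> V.span {v}"
      proof
        fix x assume "x \<in> carrier V"
        then obtain k where "x = k \<odot>\<^bsub>V\<^esub> v" by (auto simp: carrier smult)
        moreover have "k \<odot>\<^bsub>V\<^esub> v = V.lincomb (\<lambda>_. k) {v}"
          using vV by (simp add: V.lincomb_def)
        ultimately show "x \<in> V.span {v}" unfolding V.span_def by force
      qed
    qed
    moreover have "k = 0" if "k \<odot>\<^bsub>V\<^esub> v = \<zero>\<^bsub>V\<^esub>" for k
    proof (rule ccontr)
      assume "k \<noteq> 0"
      then have "v = inverse k \<odot>\<^bsub>V\<^esub> (k \<odot>\<^bsub>V\<^esub> v)"
        using v v_eq smult_eq[of "inverse k" k] by (simp add: smult)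
      then have "v = \<zero>\<^bsub>V\<^esub>" using that V.smult_r_null[of "inverse k"] by simp
      with False zero show False by simp
    qed
    then have "V.lin_indpt {v}"
      using vV by (intro V.finite_lin_indpt2) (auto simp: V.lincomb_def)
    ultimately have basis: "V.basis {v}"
      using vV by (simp add: V.basis_def)
    then have "V.fin_dim" unfolding V.fin_dim_def V.basis_def by blast
    with V.dim_basis[OF _ basis] vs False show ?thesis by (simp add: has_dimension_def)
  qed
qed

section \<open>Joins with the boundary of a simplex\<close>

text \<open>Isomorphism may use any bijection of the ground sets, but \<open>\<Delta>\<close> is a subset of the join whenever \<open>b\<close>
  is a nonface, and a finite set has no proper subset of its own cardinality.\<close>
lemma complex_iso_join_iff:
  fixes \<Delta> :: "'n::finite set set"
  assumes \<Delta>: "simplicial_complex UNIV \<Delta>" and b: "b \<notin> \<Delta>"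
  shows "complex_iso UNIV \<Delta> ((UNIV - b) \<union> b) (complex_join (deletion \<Delta> b) (simplex_boundary b))
    \<longleftrightarrow> (\<forall>F. F - b \<in> \<Delta> \<longrightarrow> \<not> b \<subseteq> F \<longrightarrow> F \<in> \<Delta>)"
    (is "complex_iso _ _ _ ?J \<longleftrightarrow> ?cond")
proof -
  have down: "G \<in> \<Delta>" if "F \<in> \<Delta>" "G \<subseteq> F" for F G
    using that \<Delta> by (auto simp: simplicial_complex_def)
  have J: "F \<in> ?J \<longleftrightarrow> F - b \<in> \<Delta> \<and> \<not> b \<subseteq> F" for F
  proof
    assume F: "F - b \<in> \<Delta> \<and> \<not> b \<subseteq> F"
    have "F - b \<in> deletion \<Delta> b" using F by (auto simp: deletion_def)
    moreover have "F \<inter> b \<in> simplex_boundary b" using F by (auto simp: simplex_boundary_def)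
    ultimately have "(F - b) \<union> (F \<inter> b) \<in> ?J"
      unfolding complex_join_def by (intro CollectI exI[of _ "F - b"] exI[of _ "F \<inter> b"]) simp
    then show "F \<in> ?J" by (simp add: Un_Diff_Int)
  next
    assume "F \<in> ?J"
    then obtain G A where G: "G \<in> \<Delta>" "G \<inter> b = {}" and A: "A \<subset> b" and F: "F = G \<union> A"
      unfolding complex_join_def deletion_def simplex_boundary_def by blast
    have "F - b = G" using F G(2) A by auto
    moreover have "\<not> b \<subseteq> F" using F G(2) A by auto
    ultimately show "F - b \<in> \<Delta> \<and> \<not> b \<subseteq> F" using G(1) by simp
  qed
  have sub: "\<Delta> \<subseteq> ?J"
    using down b by (auto simp: J)
  have "complex_iso UNIV \<Delta> ((UNIV - b) \<union> b) ?J \<longleftrightarrow> \<Delta> = ?J"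
  proof
    assume "complex_iso UNIV \<Delta> ((UNIV - b) \<union> b) ?J"
    then obtain f :: "'n \<Rightarrow> 'n" where "bij_betw f UNIV ((UNIV - b) \<union> b)" "(`) f ` \<Delta> = ?J"
      by (auto simp: complex_iso_def)
    then have "card ?J = card \<Delta>"
      using card_image[of "(`) f" \<Delta>] by (auto simp: bij_betw_def inj_on_def inj_image_eq_iff)
    with sub show "\<Delta> = ?J" by (intro card_subset_eq) auto
  next
    assume "\<Delta> = ?J"
    then show "complex_iso UNIV \<Delta> ((UNIV - b) \<union> b) ?J"
      unfolding complex_iso_def by (intro exI[of _ id]) auto
  qed
  also have "\<dots> \<longleftrightarrow> ?cond" using sub J by blast
  finally show ?thesis .
qed

section \<open>Exponent vectors and monomial ideals\<close>

text \<open>The indicator vector of \<open>b\<close> as an exponent vector, i.e. the exponent of \<open>\<Prod>i\<in>b. Var i\<close>.\<close>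
definition squarefree_exponent :: "'n::finite set \<Rightarrow> 'n \<Rightarrow>\<^sub>0 nat" where
  "squarefree_exponent b = (\<Sum>i\<in>b. Poly_Mapping.single i 1)"

lemma lookup_squarefree_exponent:
  "Poly_Mapping.lookup (squarefree_exponent b) i = (if i \<in> b then 1 else 0)"
  by (simp add: squarefree_exponent_def lookup_sum lookup_single when_def)

lemma keys_squarefree_exponent: "Poly_Mapping.keys (squarefree_exponent b) = b"
  by (auto simp: in_keys_iff lookup_squarefree_exponent split: if_splits)

lemma keys_plus_exponent:
  "Poly_Mapping.keys (m + m' :: 'n \<Rightarrow>\<^sub>0 nat) = Poly_Mapping.keys m \<union> Poly_Mapping.keys m'"
  by (auto simp: in_keys_iff lookup_add)

lemma squarefree_exponent_divides:
  assumes "b \<subseteq> Poly_Mapping.keys p"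
  shows "p = squarefree_exponent b + (p - squarefree_exponent b)"
proof (rule poly_mapping_eqI)
  fix i
  have "Poly_Mapping.lookup p i \<ge> 1" if "i \<in> b"
    using that assms by (auto simp: in_keys_iff Suc_le_eq)
  then show "Poly_Mapping.lookup p i
      = Poly_Mapping.lookup (squarefree_exponent b + (p - squarefree_exponent b)) i"
    by (simp add: lookup_add lookup_minus lookup_squarefree_exponent)
qed

lemma prod_Var: "(\<Prod>i\<in>F. Var i) = Poly_Mapping.single (squarefree_exponent F) 1"
proof (induction F rule: infinite_finite_induct)
  case (insert i F)
  then show ?case by (simp add: Var_def mult_single squarefree_exponent_def)
qed (auto simp: squarefree_exponent_def)

text \<open>For properties of polynomials supported on a fixed set \<open>A\<close> of exponents; in the step for sums both
  summands are supported on \<open>A\<close> as well, so the rule can be used inside a monomial ideal.\<close>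
lemma poly_mapping_induct_monomial [consumes 1, case_names zero monomial add]:
  fixes f :: "'a \<Rightarrow>\<^sub>0 'b::comm_monoid_add"
  assumes f: "Poly_Mapping.keys f \<subseteq> A"
    and zero: "P 0"
    and monomial: "\<And>m c. m \<in> A \<Longrightarrow> P (Poly_Mapping.single m c)"
    and add: "\<And>g h. Poly_Mapping.keys g \<subseteq> A \<Longrightarrow> Poly_Mapping.keys h \<subseteq> A \<Longrightarrow> P g \<Longrightarrow> P h \<Longrightarrow> P (g + h)"
  shows "P f"
proof -
  let ?s = "\<lambda>B. \<Sum>m\<in>B. Poly_Mapping.single m (Poly_Mapping.lookup f m)"
  have "f = ?s (Poly_Mapping.keys f)"
    by (rule poly_mapping_eqI) (simp add: lookup_sum lookup_single when_def in_keys_iff)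
  moreover have "Poly_Mapping.keys (?s B) \<subseteq> A \<and> P (?s B)" if "finite B" "B \<subseteq> A" for B
    using that
  proof (induction B)
    case (insert m B)
    have "Poly_Mapping.keys (Poly_Mapping.single m (Poly_Mapping.lookup f m)) \<subseteq> A"
      using insert.prems by simp
    with insert show ?case
      using monomial[of m] add keys_add[of "Poly_Mapping.single m (Poly_Mapping.lookup f m)" "?s B"]
      by (auto 4 3)
  qed (simp add: zero)
  ultimately show ?thesis using f by (metis finite_keys)
qed

lemma Const_ring_hom: "Const \<in> Ring.ring_hom class_ring S_ring"
  by (rule ring_hom_memI) (auto simp: Const_def mult_single single_add)

lemma lookup_Const_mult:
  "Poly_Mapping.lookup (Const k * f) m = k * Poly_Mapping.lookup f m"
  by (simp add: Const_def mult_map_scale_conv_mult[symmetric] Poly_Mapping.map.rep_eq when_def)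

lemma keys_multE:
  fixes f g :: "('n, 'k::field) mpoly"
  assumes "m \<in> Poly_Mapping.keys (f * g)"
  obtains p q where "p \<in> Poly_Mapping.keys f" "q \<in> Poly_Mapping.keys g" "m = p + q"
  using assms keys_mult[of f g] by blast

text \<open>Multiplication only enlarges the supports of exponents, and nonfaces are closed under supersets.\<close>
lemma ideal_nonface_span:
  assumes "simplicial_complex UNIV \<Delta>"
  shows "ideal {f :: ('n::finite, 'k::field) mpoly. \<forall>m\<in>Poly_Mapping.keys f. Poly_Mapping.keys m \<notin> \<Delta>} S_ring"
    (is "ideal ?J _")
proof -
  define J where "J = ?J"
  have zero: "0 \<in> J" by (simp add: J_def)
  have add: "f + g \<in> J" if "f \<in> J" "g \<in> J" for f g
    using that keys_add[of f g] unfolding J_def by blast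
  have mult: "g * f \<in> J" if f: "f \<in> J" for f g
    unfolding J_def
  proof safe
    fix m assume "m \<in> Poly_Mapping.keys (g * f)" and m: "Poly_Mapping.keys m \<in> \<Delta>"
    then obtain p q where "q \<in> Poly_Mapping.keys f" "m = p + q" by (blast elim: keys_multE)
    then show False using f m assms by (auto simp: keys_plus_exponent simplicial_complex_def J_def)
  qed
  have mult': "f * g \<in> J" if "f \<in> J" for f g
    using mult[OF that, of g] by (simp add: mult.commute)
  have minus: "- f \<in> J" if "f \<in> J" for f
    using mult[OF that, of "- 1"] by simp
  have "subgroup J (add_monoid S_ring)"
  proof (rule subgroup.intro)
    fix f assume "f \<in> J"
    then have "\<ominus>\<^bsub>S_ring\<^esub> f \<in> J" by (simp add: class_ring_simps minus)
    then show "inv\<^bsub>add_monoid S_ring\<^esub> f \<in> J" by (simp add: a_inv_def)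
  qed (simp_all add: add zero)
  then have "ideal J S_ring"
    by (rule idealI[OF class_ring.ring_axioms]) (simp_all add: mult mult')
  then show ?thesis by (simp add: J_def)
qed

text \<open>This reduces membership in the ideal to a condition on single coefficients, and shows that with a
  polynomial the ideal contains each of its monomials.\<close>
lemma stanley_reisner_ideal_eq:
  assumes \<Delta>: "simplicial_complex UNIV \<Delta>"
  shows "stanley_reisner_ideal \<Delta>
    = {f :: ('n::finite, 'k::field) mpoly. \<forall>m\<in>Poly_Mapping.keys f. Poly_Mapping.keys m \<notin> \<Delta>}"
    (is "?I = ?J")
proof
  let ?G = "{\<Prod>i\<in>F. Var i |F. F \<notin> \<Delta>} :: ('n, 'k) mpoly set"
  have "?G \<subseteq> ?J" by (auto simp: prod_Var keys_squarefree_exponent)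
  then show "?I \<subseteq> ?J"
    unfolding stanley_reisner_ideal_def
    by (intro ring.genideal_minimal class_ring.ring_axioms ideal_nonface_span[OF \<Delta>])
  interpret I: ideal ?I S_ring
    unfolding stanley_reisner_ideal_def by (rule ring.genideal_ideal[OF class_ring.ring_axioms]) simp
  have gen: "?G \<subseteq> ?I"
    unfolding stanley_reisner_ideal_def by (rule ring.genideal_self[OF class_ring.ring_axioms]) simp
  show "?J \<subseteq> ?I"
  proof
    fix f assume "f \<in> ?J"
    then have "Poly_Mapping.keys f \<subseteq> {m. Poly_Mapping.keys m \<notin> \<Delta>}" by auto
    then show "f \<in> ?I"
    proof (induction rule: poly_mapping_induct_monomial)
      case zero
      show ?case using I.zero_closed by simp
    next
      case (monomial m c)
      let ?F = "Poly_Mapping.keys m"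
      have "(\<Prod>i\<in>?F. Var i) \<in> ?I" using monomial gen by blast
      then have "Poly_Mapping.single (m - squarefree_exponent ?F) c * (\<Prod>i\<in>?F. Var i) \<in> ?I"
        using I.I_l_closed by simp
      then show ?case
        using squarefree_exponent_divides[of ?F m] by (simp add: prod_Var mult_single add.commute)
    next
      case (add g h)
      then show ?case using I.a_closed by simp
    qed
  qed
qed

section \<open>Homomorphisms from an ideal to its residue ring\<close>

abbreviation residue :: "('n, 'k::field) mpoly set \<Rightarrow> ('n, 'k) mpoly \<Rightarrow> ('n, 'k) mpoly set" where
  "residue I f \<equiv> I +>\<^bsub>S_ring\<^esub> f"

locale polynomial_ideal =
  fixes I :: "('n, 'k::field) mpoly set"
  assumes ideal: "ideal I S_ring"
begin

sublocale I: ideal I S_ring by (rule ideal)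

lemma zero_mem: "0 \<in> I" using I.zero_closed by simp

lemma add_mem: "f \<in> I \<Longrightarrow> g \<in> I \<Longrightarrow> f + g \<in> I" using I.a_closed by simp

lemma mult_mem: "f \<in> I \<Longrightarrow> g * f \<in> I" using I.I_l_closed by simp

lemma residue_eq_iff: "residue I f = residue I g \<longleftrightarrow> f - g \<in> I"
  using ring.quotient_eq_iff_same_a_r_cos[OF class_ring.ring_axioms ideal, of f g]
  by (simp add: class_ring_simps)

lemma module_ideal: "Module.module S_ring (ideal_module I)"
  by (intro Module.submodule.submodule_is_module submodule_regular_module module_regular_module
      ideal class_cring.is_cring)

lemma module_residue: "Module.module S_ring (residue_module I)"
  by (intro module_quotient_module submodule_regular_module module_regular_module
      ideal class_cring.is_cring)

lemma residue_module_carrier: "carrier (residue_module I) = range (residue I)"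
  by (simp add: quotient_module_carrier a_r_coset_regular_module) (simp add: regular_module_def)

lemma residue_module_zero: "\<zero>\<^bsub>residue_module I\<^esub> = residue I 0"
proof -
  have "I = residue I 0" by (simp add: a_r_coset_def')
  then show ?thesis by (simp add: quotient_module_def)
qed

lemma residue_module_add:
  "residue I f \<oplus>\<^bsub>residue_module I\<^esub> residue I g = residue I (f + g)"
  using quotient_module_add[OF module_regular_module submodule_regular_module,
      OF class_cring.is_cring ideal class_cring.is_cring, of f g]
  by (simp add: a_r_coset_regular_module) (simp add: regular_module_def)

lemma residue_module_smult:
  "a \<odot>\<^bsub>residue_module I\<^esub> residue I g = residue I (a * g)"
  using quotient_module_smult[OF module_regular_module submodule_regular_module,
      OF class_cring.is_cring ideal class_cring.is_cring, of g a]
  by (simp add: a_r_coset_regular_module) (simp add: regular_module_def)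

lemma module_normal: "Module.module S_ring (normal_module I)"
  unfolding normal_module_def by (rule module_Hom_module[OF module_ideal module_residue])

lemma normal_module_carrier:
  "\<phi> \<in> carrier (normal_module I) \<longleftrightarrow>
    \<phi> \<in> extensional I \<and> (\<forall>f\<in>I. \<phi> f \<in> range (residue I)) \<and>
    (\<forall>f\<in>I. \<forall>g\<in>I. \<phi> (f + g) = \<phi> f \<oplus>\<^bsub>residue_module I\<^esub> \<phi> g) \<and>
    (\<forall>a. \<forall>f\<in>I. \<phi> (a * f) = a \<odot>\<^bsub>residue_module I\<^esub> \<phi> f)"
  unfolding normal_module_def Hom_module_carrier residue_module_carrier Pi_iff
  by (simp add: regular_module_def)

text \<open>A map \<open>D\<close> on polynomials represents a homomorphism \<open>I \<rightarrow> S/I\<close> as soon as it is linear on \<open>I\<close> up to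
  errors in \<open>I\<close>; the contraction and the derivations are both of this kind.\<close>
lemma normal_module_memI:
  assumes "\<And>f g. f \<in> I \<Longrightarrow> g \<in> I \<Longrightarrow> D (f + g) - (D f + D g) \<in> I"
    and "\<And>a f. f \<in> I \<Longrightarrow> D (a * f) - a * D f \<in> I"
  shows "(\<lambda>f\<in>I. residue I (D f)) \<in> carrier (normal_module I)"
  unfolding normal_module_carrier
  using assms
  by (auto simp: residue_module_add residue_module_smult residue_eq_iff add_mem mult_mem)

lemma normal_module_zero: "\<zero>\<^bsub>normal_module I\<^esub> = (\<lambda>f\<in>I. residue I 0)"
  by (simp add: normal_module_def Hom_module_def residue_module_zero)

lemma normal_module_add:
  "(\<lambda>f\<in>I. residue I (D f)) \<oplus>\<^bsub>normal_module I\<^esub> (\<lambda>f\<in>I. residue I (E f)) = (\<lambda>f\<in>I. residue I (D f + E f))"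
  by (simp add: normal_module_def Hom_module_def residue_module_add
      cong: restrict_cong)

lemma normal_module_smult:
  "a \<odot>\<^bsub>normal_module I\<^esub> (\<lambda>f\<in>I. residue I (D f)) = (\<lambda>f\<in>I. residue I (a * D f))"
  by (simp add: normal_module_def Hom_module_def residue_module_smult
      cong: restrict_cong)

text \<open>The map \<open>f \<mapsto> d f + I\<close> is linear on \<open>I\<close>, although \<open>d\<close> is not, since the product rule gives
  \<open>d (a f) = a (d f) + f (d a)\<close> and the last term is in \<open>I\<close>.\<close>
lemma submodule_derivations:
  "Module.submodule (derivation_hom I ` derivations) S_ring (normal_module I)" (is "Module.submodule ?N _ _")
proof -
  interpret M: Module.module S_ring "normal_module I" by (rule module_normal)
  have carrier: "?N \<subseteq> carrier (normal_module I)"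
  proof
    fix \<phi> assume "\<phi> \<in> ?N"
    then obtain d where d: "d \<in> derivations" "\<phi> = derivation_hom I d" by blast
    have "d (a * f) - a * d f \<in> I" if "f \<in> I" for a f
      using d(1) mult_mem[OF that, of "d a"] by (simp add: derivations_def mult.commute)
    then show "\<phi> \<in> carrier (normal_module I)"
      using d unfolding derivation_hom_def
      by (auto intro!: normal_module_memI simp: derivations_def zero_mem)
  qed
  have smult: "a \<odot>\<^bsub>normal_module I\<^esub> \<phi> \<in> ?N" if "\<phi> \<in> ?N" for a \<phi>
  proof -
    obtain d where d: "d \<in> derivations" "\<phi> = derivation_hom I d" using \<open>\<phi> \<in> ?N\<close> by blast
    have "(\<lambda>f. a * d f) \<in> derivations"
      unfolding derivations_def
    proof (intro CollectI conjI allI)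
      fix c f
      have "d (Const c * f) = Const c * d f" using d(1) unfolding derivations_def by blast
      then show "a * d (Const c * f) = Const c * (a * d f)" by (simp add: mult.left_commute)
    qed (use d(1) in \<open>simp_all add: derivations_def algebra_simps\<close>)
    then show ?thesis using d(2) by (auto simp: derivation_hom_def normal_module_smult)
  qed
  show ?thesis
  proof (rule M.submoduleI[OF carrier])
    have "(\<lambda>_. 0) \<in> derivations" by (simp add: derivations_def)
    then have "derivation_hom I (\<lambda>_. 0) \<in> ?N" by blast
    then show "\<zero>\<^bsub>normal_module I\<^esub> \<in> ?N" by (simp add: derivation_hom_def normal_module_zero)
  next
    fix \<phi> assume \<phi>: "\<phi> \<in> ?N"
    then have \<phi>c: "\<phi> \<in> carrier (normal_module I)" using carrier by blast
    have "\<ominus>\<^bsub>normal_module I\<^esub> \<phi> = - 1 \<odot>\<^bsub>normal_module I\<^esub> \<phi>"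
      using M.smult_l_minus[OF _ \<phi>c, of 1] M.smult_one[OF \<phi>c] by (simp add: class_ring_simps)
    then show "\<ominus>\<^bsub>normal_module I\<^esub> \<phi> \<in> ?N" using smult[OF \<phi>] by simp
  next
    fix \<phi> \<psi> assume "\<phi> \<in> ?N" "\<psi> \<in> ?N"
    then obtain d e where d: "d \<in> derivations" "\<phi> = derivation_hom I d"
      and e: "e \<in> derivations" "\<psi> = derivation_hom I e" by blast
    have "(\<lambda>f. d f + e f) \<in> derivations"
      unfolding derivations_def
    proof (intro CollectI conjI allI)
      fix c f
      have "d (Const c * f) = Const c * d f" "e (Const c * f) = Const c * e f"
        using d(1) e(1) unfolding derivations_def by blast+
      then show "d (Const c * f) + e (Const c * f) = Const c * (d f + e f)"
        by (simp add: distrib_left)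
    qed (use d(1) e(1) in \<open>simp_all add: derivations_def algebra_simps\<close>)
    then show "\<phi> \<oplus>\<^bsub>normal_module I\<^esub> \<psi> \<in> ?N"
      using d(2) e(2) by (auto simp: derivation_hom_def normal_module_add)
  qed (rule smult)
qed

text \<open>The class of \<open>\<psi>\<close> spans the component, and it is zero exactly when \<open>\<psi>\<close> comes from a derivation.\<close>
lemma T1_component_has_dimension:
  assumes \<psi>: "\<psi> \<in> carrier (normal_module I)"
    and comp: "normal_component I c = range (\<lambda>k. Const k \<odot>\<^bsub>normal_module I\<^esub> \<psi>)"
  shows "has_dimension class_ring (T1_component I c)
    (if \<psi> \<in> derivation_hom I ` derivations then 0 else 1)"
proof -
  let ?N = "derivation_hom I ` derivations"
  note M = module_normal and N = submodule_derivations
  have "has_dimension class_ring (T1_component I c)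
    (if ?N +>\<^bsub>normal_module I\<^esub> \<psi> = \<zero>\<^bsub>T1 I\<^esub> then 0 else 1)"
  proof (rule has_dimension_multiples[where h = Const and R = S_ring])
    show "Module.module S_ring (T1 I)"
      unfolding T1_def by (rule module_quotient_module[OF M N])
    show "?N +>\<^bsub>normal_module I\<^esub> \<psi> \<in> carrier (T1 I)"
      using \<psi> by (simp add: T1_def quotient_module_carrier)
    have "Const k \<odot>\<^bsub>T1 I\<^esub> (?N +>\<^bsub>normal_module I\<^esub> \<psi>)
        = ?N +>\<^bsub>normal_module I\<^esub> (Const k \<odot>\<^bsub>normal_module I\<^esub> \<psi>)" for k
      unfolding T1_def by (rule quotient_module_smult[OF M N \<psi>]) simp
    then show "carrier (T1_component I c)
        = range (\<lambda>k. Const k \<odot>\<^bsub>T1 I\<^esub> (?N +>\<^bsub>normal_module I\<^esub> \<psi>))"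
      by (simp add: T1_component_def comp image_image)
  qed (simp_all add: T1_component_def Const_ring_hom)
  moreover have "\<zero>\<^bsub>T1 I\<^esub> = ?N" by (simp add: T1_def quotient_module_def)
  ultimately show ?thesis
    using coset_eq_submodule_iff[OF M N \<psi>] by simp
qed

end

section \<open>Contraction by a squarefree monomial\<close>

text \<open>The transpose of multiplication by \<open>x^b\<close>: the coefficient of \<open>x^m\<close> becomes that of \<open>x^b x^m\<close>.
  Thus \<open>x^b x^m\<close> goes to \<open>x^m\<close>, and monomials not divisible by \<open>x^b\<close> go to 0.\<close>
definition contract :: "'n::finite set \<Rightarrow> ('n, 'k::field) mpoly \<Rightarrow> ('n, 'k) mpoly" where
  "contract b = Poly_Mapping.map_key (\<lambda>m. squarefree_exponent b + m)"

lemma lookup_contract: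
  "Poly_Mapping.lookup (contract b f) m = Poly_Mapping.lookup f (squarefree_exponent b + m)"
  by (simp add: contract_def Poly_Mapping.map_key.rep_eq inj_on_def)

lemma contract_add: "contract b (f + g) = contract b f + contract b g"
  by (rule poly_mapping_eqI) (simp add: lookup_contract lookup_add)

lemma contract_zero: "contract b 0 = 0"
  by (rule poly_mapping_eqI) (simp add: lookup_contract)

lemma contract_monomial:
  "contract b (Poly_Mapping.single (squarefree_exponent b + q) c) = Poly_Mapping.single q c"
  by (rule poly_mapping_eqI) (simp add: lookup_contract lookup_single when_def)

lemma contract_monomial_eq_zero:
  assumes "\<not> b \<subseteq> Poly_Mapping.keys p"
  shows "contract b (Poly_Mapping.single p c) = 0"
proof (rule poly_mapping_eqI)
  fix m
  have "p \<noteq> squarefree_exponent b + m"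
    using assms by (auto simp: keys_plus_exponent keys_squarefree_exponent)
  then show "Poly_Mapping.lookup (contract b (Poly_Mapping.single p c)) m = Poly_Mapping.lookup 0 m"
    by (simp add: lookup_contract lookup_single)
qed

lemma keys_contract: "m \<in> Poly_Mapping.keys (contract b f) \<longleftrightarrow> squarefree_exponent b + m \<in> Poly_Mapping.keys f"
  by (simp add: in_keys_iff lookup_contract)

lemma contract_homogeneous:
  assumes "f \<in> homogeneous_part a"
  shows "contract b f \<in> homogeneous_part (\<lambda>i. a i + - indicator b i)"
  unfolding homogeneous_part_def
proof safe
  fix m i assume "m \<in> Poly_Mapping.keys (contract b f)"
  then have "int (Poly_Mapping.lookup (squarefree_exponent b + m) i) = a i"
    using assms by (simp add: keys_contract homogeneous_part_def)
  then show "int (Poly_Mapping.lookup m i) = a i + - indicator b i"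
    by (auto simp: lookup_add lookup_squarefree_exponent indicator_def)
qed

section \<open>Partial derivatives\<close>

text \<open>The partial derivative, as the operator \<open>x\<^sub>i \<partial>/\<partial>x\<^sub>i\<close>, which is diagonal on monomials, followed by
  division by \<open>x\<^sub>i\<close>.\<close>
definition partial :: "'n::finite \<Rightarrow> ('n, 'k::field) mpoly \<Rightarrow> ('n, 'k) mpoly" where
  "partial i f = contract {i} (Poly_Mapping.mapp (\<lambda>m c. of_nat (Poly_Mapping.lookup m i) * c) f)"

lemma lookup_partial:
  "Poly_Mapping.lookup (partial i f) m
    = of_nat (Suc (Poly_Mapping.lookup m i)) * Poly_Mapping.lookup f (squarefree_exponent {i} + m)"
  by (simp add: partial_def lookup_contract lookup_mapp lookup_add lookup_squarefree_exponent
      when_def in_keys_iff)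

lemma partial_add: "partial i (f + g) = partial i f + partial i g"
  by (rule poly_mapping_eqI) (simp add: lookup_partial lookup_add algebra_simps)

lemma partial_zero: "partial i 0 = 0"
  by (rule poly_mapping_eqI) (simp add: lookup_partial)

lemma partial_monomial:
  "partial i (Poly_Mapping.single p c)
    = Poly_Mapping.single (p - squarefree_exponent {i}) (of_nat (Poly_Mapping.lookup p i) * c)"
proof (cases "i \<in> Poly_Mapping.keys p")
  case True
  then obtain q where p: "p = squarefree_exponent {i} + q"
    using squarefree_exponent_divides[of "{i}" p] by auto
  show ?thesis
    by (rule poly_mapping_eqI)
      (simp add: p lookup_partial lookup_single lookup_add lookup_squarefree_exponent when_def)
next
  case False
  then have "p \<noteq> squarefree_exponent {i} + m" for m
    by (auto simp: keys_plus_exponent keys_squarefree_exponent)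
  with False show ?thesis
    by (intro poly_mapping_eqI) (simp add: lookup_partial lookup_single in_keys_iff)
qed

lemma partial_mult_monomials:
  fixes c d :: "'k::field"
  shows "partial i (Poly_Mapping.single p c * Poly_Mapping.single q d)
    = Poly_Mapping.single p c * partial i (Poly_Mapping.single q d)
      + Poly_Mapping.single q d * partial i (Poly_Mapping.single p c)"
proof -
  let ?e = "squarefree_exponent {i}"
  \<comment> \<open>Subtraction of exponents is truncated; where it truncates, the coefficient is zero.\<close>
  have shift: "Poly_Mapping.single (p + (q - ?e)) (of_nat (Poly_Mapping.lookup q i) * x)
      = Poly_Mapping.single (p + q - ?e) (of_nat (Poly_Mapping.lookup q i) * x)"
    for p q :: "'a \<Rightarrow>\<^sub>0 nat" and x :: 'k
  proof (cases "i \<in> Poly_Mapping.keys q")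
    case True
    then have "q = ?e + (q - ?e)" using squarefree_exponent_divides[of "{i}" q] by simp
    then have "p + q - ?e = ?e + (p + (q - ?e)) - ?e" by (metis add.left_commute)
    then have "p + (q - ?e) = p + q - ?e" by simp
    then show ?thesis by simp
  qed (simp add: in_keys_iff)
  show ?thesis
    using shift[of p q "c * d"] shift[of q p "c * d"]
    by (simp add: partial_monomial mult_single lookup_add single_add[symmetric] algebra_simps)
qed

lemma partial_derivation: "partial i \<in> derivations"
  unfolding derivations_def
proof (intro CollectI conjI allI)
  fix f g :: "('a, 'b) mpoly"
  show "partial i (f * g) = f * partial i g + g * partial i f"
  proof (induction f rule: poly_mapping_induct_monomial[of _ UNIV, OF subset_UNIV, case_names zero monomial add])
    case (monomial p c)
    show ?case
    proof (induction g rule: poly_mapping_induct_monomial[of _ UNIV, OF subset_UNIV, case_names zero monomial add])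
      case (monomial q d)
      show ?case by (rule partial_mult_monomials)
    qed (simp_all add: partial_zero partial_add algebra_simps)
  qed (simp_all add: partial_zero partial_add algebra_simps)
next
  fix c and f :: "('a, 'b) mpoly"
  show "partial i (Const c * f) = Const c * partial i f"
    by (rule poly_mapping_eqI) (simp add: lookup_partial lookup_Const_mult mult.left_commute)
qed (rule partial_add)

section \<open>The degree component for a nonface\<close>

locale stanley_reisner =
  fixes \<Delta> :: "'n::finite set set" and I :: "('n, 'k::field) mpoly set"
  assumes complex: "simplicial_complex UNIV \<Delta>" and nonvoid: "\<Delta> \<noteq> {}"
  defines "I \<equiv> stanley_reisner_ideal \<Delta>"
begin

lemma mem_iff: "f \<in> I \<longleftrightarrow> (\<forall>m\<in>Poly_Mapping.keys f. Poly_Mapping.keys m \<notin> \<Delta>)"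
  unfolding I_def stanley_reisner_ideal_eq[OF complex] by simp

sublocale polynomial_ideal I
  unfolding I_def stanley_reisner_ideal_eq[OF complex]
  by (intro polynomial_ideal.intro ideal_nonface_span complex)

lemma face_mono: "F \<in> \<Delta> \<Longrightarrow> G \<subseteq> F \<Longrightarrow> G \<in> \<Delta>"
  using complex by (auto simp: simplicial_complex_def)

lemma empty_face: "{} \<in> \<Delta>"
  using nonvoid face_mono by blast

lemma monomial_mem: "Poly_Mapping.keys m \<notin> \<Delta> \<Longrightarrow> Poly_Mapping.single m c \<in> I"
  by (simp add: mem_iff)

lemma induct_ideal [consumes 1, case_names zero monomial add]:
  assumes "f \<in> I" and "P 0"
    and "\<And>m c. Poly_Mapping.keys m \<notin> \<Delta> \<Longrightarrow> P (Poly_Mapping.single m c)"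
    and "\<And>g h. g \<in> I \<Longrightarrow> h \<in> I \<Longrightarrow> P g \<Longrightarrow> P h \<Longrightarrow> P (g + h)"
  shows "P f"
proof (rule poly_mapping_induct_monomial[of f "{m. Poly_Mapping.keys m \<notin> \<Delta>}"])
  show "Poly_Mapping.keys f \<subseteq> {m. Poly_Mapping.keys m \<notin> \<Delta>}" using assms(1) by (auto simp: mem_iff)
  show "P (g + h)" if "Poly_Mapping.keys g \<subseteq> {m. Poly_Mapping.keys m \<notin> \<Delta>}"
    "Poly_Mapping.keys h \<subseteq> {m. Poly_Mapping.keys m \<notin> \<Delta>}" "P g" "P h" for g h
    by (rule assms(4)) (use that in \<open>auto simp: mem_iff\<close>)
qed (use assms in auto)

text \<open>On monomials \<open>g = x^p\<close> and \<open>f = x^q\<close> the two terms agree unless \<open>x^b\<close> divides the product but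
  not \<open>x^q\<close>. In that case only \<open>x^(p + q - b)\<close> remains; its support contains \<open>supp q - b\<close>, a nonface
  by the assumption on \<open>\<Delta>\<close>.\<close>
lemma contract_linear_mod_ideal:
  assumes split: "\<And>F. F - b \<in> \<Delta> \<Longrightarrow> \<not> b \<subseteq> F \<Longrightarrow> F \<in> \<Delta>" and f: "f \<in> I"
  shows "contract b (g * f) - g * contract b f \<in> I"
  using f
proof (induction f rule: induct_ideal)
  case zero
  show ?case by (simp add: contract_zero zero_mem)
next
  case (add f h)
  from add_mem[OF add.IH] show ?case by (simp add: contract_add algebra_simps)
next
  case (monomial q c)
  show ?case
  proof (induction g rule: poly_mapping_induct_monomial[of _ UNIV, OF subset_UNIV, case_names zero monomial add])
    case zero
    show ?case by (simp add: contract_zero zero_mem)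
  next
    case (add g h)
    from add_mem[OF add.IH] show ?case by (simp add: contract_add algebra_simps)
  next
    case (monomial p d)
    consider (q) "b \<subseteq> Poly_Mapping.keys q"
      | (sum) "\<not> b \<subseteq> Poly_Mapping.keys q" "b \<subseteq> Poly_Mapping.keys (p + q)"
      | (none) "\<not> b \<subseteq> Poly_Mapping.keys (p + q)"
      by (auto simp: keys_plus_exponent)
    then show ?case
    proof cases
      case q
      define r where "r = q - squarefree_exponent b"
      have "q = squarefree_exponent b + r"
        unfolding r_def by (rule squarefree_exponent_divides[OF q])
      then show ?thesis
        using contract_monomial[of b "p + r" "d * c"] contract_monomial[of b r c]
        by (simp add: mult_single zero_mem add.left_commute)
    next
      case sum
      define r where "r = p + q - squarefree_exponent b"
      have pq: "p + q = squarefree_exponent b + r"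
        unfolding r_def by (rule squarefree_exponent_divides[OF sum(2)])
      have "Poly_Mapping.keys q - b \<subseteq> Poly_Mapping.keys r"
      proof
        fix i assume "i \<in> Poly_Mapping.keys q - b"
        then have "i \<in> Poly_Mapping.keys (squarefree_exponent b + r) - b"
          unfolding pq[symmetric] keys_plus_exponent by blast
        then show "i \<in> Poly_Mapping.keys r"
          by (auto simp: keys_plus_exponent keys_squarefree_exponent)
      qed
      moreover have "Poly_Mapping.keys q - b \<notin> \<Delta>"
        using split[OF _ sum(1)] \<open>Poly_Mapping.keys q \<notin> \<Delta>\<close> by blast
      ultimately have "Poly_Mapping.keys r \<notin> \<Delta>" using face_mono by blast
      then show ?thesis
        by (simp add: mult_single pq contract_monomial contract_monomial_eq_zero[OF sum(1)] monomial_mem)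
    next
      case none
      then have "\<not> b \<subseteq> Poly_Mapping.keys q" by (auto simp: keys_plus_exponent)
      with none show ?thesis
        by (simp add: mult_single contract_monomial_eq_zero zero_mem)
    qed
  qed
qed

lemma contract_normal:
  assumes "\<And>F. F - b \<in> \<Delta> \<Longrightarrow> \<not> b \<subseteq> F \<Longrightarrow> F \<in> \<Delta>"
  shows "(\<lambda>f\<in>I. residue I (contract b f)) \<in> carrier (normal_module I)"
  using contract_linear_mod_ideal[OF assms]
  by (intro normal_module_memI) (simp_all add: contract_add zero_mem)

text \<open>The scalar is the constant to which \<open>x^b\<close> is mapped; degrees leave no choice for the other monomials.\<close>
lemma normal_component_scalar:
  assumes b: "b \<notin> \<Delta>" and \<phi>: "\<phi> \<in> normal_component I (\<lambda>i. - indicator b i)"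
  shows "\<exists>k. \<phi> = (\<lambda>f\<in>I. residue I (Const k * contract b f))"
proof -
  let ?xb = "Poly_Mapping.single (squarefree_exponent b) 1 :: ('n, 'k) mpoly"
  have \<phi>_car: "\<phi> \<in> carrier (normal_module I)" using \<phi> by (simp add: normal_component_def)
  have ext: "\<phi> \<in> extensional I"
    and add: "\<And>f g. f \<in> I \<Longrightarrow> g \<in> I \<Longrightarrow> \<phi> (f + g) = \<phi> f \<oplus>\<^bsub>residue_module I\<^esub> \<phi> g"
    and smult: "\<And>a f. f \<in> I \<Longrightarrow> \<phi> (a * f) = a \<odot>\<^bsub>residue_module I\<^esub> \<phi> f"
    using \<phi>_car unfolding normal_module_carrier by blast+
  \<comment> \<open>A residue of degree \<open>p - b\<close> has a representative in which only \<open>x^(p - b)\<close> can occur; in particular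
    it vanishes if \<open>x^b\<close> does not divide \<open>x^p\<close>.\<close>
  have monomial_degree: "\<exists>g. \<phi> (Poly_Mapping.single p c) = residue I g \<and>
      (\<forall>m\<in>Poly_Mapping.keys g. p = squarefree_exponent b + m)"
    if "Poly_Mapping.keys p \<notin> \<Delta>" for p c
  proof -
    let ?a = "\<lambda>i. int (Poly_Mapping.lookup p i)"
    have "Poly_Mapping.single p c \<in> I \<inter> homogeneous_part ?a"
      using monomial_mem[OF that] by (simp add: homogeneous_part_def)
    moreover have "\<forall>f \<in> I \<inter> homogeneous_part ?a.
        \<phi> f \<in> residue I ` homogeneous_part (\<lambda>i. ?a i + - indicator b i)"
      using \<phi> by (simp add: normal_component_def)
    ultimately have "\<phi> (Poly_Mapping.single p c)
        \<in> residue I ` homogeneous_part (\<lambda>i. ?a i + - indicator b i)" by (rule bspec[rotated])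
    then obtain g where g: "g \<in> homogeneous_part (\<lambda>i. ?a i + - indicator b i)"
      and "\<phi> (Poly_Mapping.single p c) = residue I g" by (elim imageE)
    moreover have "p = squarefree_exponent b + m" if "m \<in> Poly_Mapping.keys g" for m
    proof (rule poly_mapping_eqI)
      fix i
      have "int (Poly_Mapping.lookup m i) = ?a i - indicator b i"
        using g that by (simp add: homogeneous_part_def)
      then show "Poly_Mapping.lookup p i = Poly_Mapping.lookup (squarefree_exponent b + m) i"
        by (auto simp: lookup_add lookup_squarefree_exponent indicator_def split: if_splits)
    qed
    ultimately show ?thesis by blast
  qed
  have xb: "?xb \<in> I" using b by (simp add: monomial_mem keys_squarefree_exponent)
  obtain g where g: "\<phi> ?xb = residue I g"
      "\<And>m. m \<in> Poly_Mapping.keys g \<Longrightarrow> squarefree_exponent b = squarefree_exponent b + m"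
    using monomial_degree[of "squarefree_exponent b" 1] b by (auto simp: keys_squarefree_exponent)
  define k where "k = Poly_Mapping.lookup g 0"
  have "g = Const k"
  proof (rule poly_mapping_eqI)
    fix m show "Poly_Mapping.lookup g m = Poly_Mapping.lookup (Const k) m"
      using g(2)[of m] by (cases "m = 0") (auto simp: k_def Const_def lookup_single in_keys_iff)
  qed
  with g(1) have \<phi>_xb: "\<phi> ?xb = residue I (Const k)" by simp
  have "\<phi> f = residue I (Const k * contract b f)" if "f \<in> I" for f
    using that
  proof (induction f rule: induct_ideal)
    case zero
    show ?case
      using smult[OF xb, of 0] by (simp add: \<phi>_xb residue_module_smult contract_zero)
  next
    case (add f h)
    then show ?case
      by (simp add: \<open>\<And>f g. f \<in> I \<Longrightarrow> g \<in> I \<Longrightarrow> \<phi> (f + g) = \<phi> f \<oplus>\<^bsub>residue_module I\<^esub> \<phi> g\<close>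
          residue_module_add contract_add distrib_left)
  next
    case (monomial p c)
    show ?case
    proof (cases "b \<subseteq> Poly_Mapping.keys p")
      case True
      define q where "q = p - squarefree_exponent b"
      have p: "p = squarefree_exponent b + q"
        unfolding q_def by (rule squarefree_exponent_divides[OF True])
      have "Poly_Mapping.single p c = Poly_Mapping.single q c * ?xb"
        by (simp add: p mult_single add.commute)
      then have "\<phi> (Poly_Mapping.single p c) = residue I (Poly_Mapping.single q c * Const k)"
        using smult[OF xb, of "Poly_Mapping.single q c"] by (simp add: \<phi>_xb residue_module_smult)
      then show ?thesis by (simp add: p contract_monomial mult.commute)
    next
      case False
      obtain g where g: "\<phi> (Poly_Mapping.single p c) = residue I g"
          "\<And>m. m \<in> Poly_Mapping.keys g \<Longrightarrow> p = squarefree_exponent b + m"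
        using monomial_degree[OF monomial] by blast
      have "m \<notin> Poly_Mapping.keys g" for m
        using g(2)[of m] False by (auto simp: keys_plus_exponent keys_squarefree_exponent)
      then have "g = 0" by (intro poly_mapping_eqI) (simp add: in_keys_iff)
      with g(1) show ?thesis by (simp add: contract_monomial_eq_zero[OF False])
    qed
  qed
  then show ?thesis
    using ext by (intro exI[of _ k] extensionalityI[of _ I]) auto
qed

lemma normal_component_split:
  assumes b: "b \<notin> \<Delta>" and split: "\<And>F. F - b \<in> \<Delta> \<Longrightarrow> \<not> b \<subseteq> F \<Longrightarrow> F \<in> \<Delta>"
  shows "normal_component I (\<lambda>i. - indicator b i)
    = range (\<lambda>k. Const k \<odot>\<^bsub>normal_module I\<^esub> (\<lambda>f\<in>I. residue I (contract b f)))"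
proof (intro equalityI subsetI)
  fix \<phi> assume "\<phi> \<in> normal_component I (\<lambda>i. - indicator b i)"
  from normal_component_scalar[OF b this]
  show "\<phi> \<in> range (\<lambda>k. Const k \<odot>\<^bsub>normal_module I\<^esub> (\<lambda>f\<in>I. residue I (contract b f)))"
    by (auto simp: normal_module_smult)
next
  interpret M: Module.module S_ring "normal_module I" by (rule module_normal)
  fix \<phi> assume "\<phi> \<in> range (\<lambda>k. Const k \<odot>\<^bsub>normal_module I\<^esub> (\<lambda>f\<in>I. residue I (contract b f)))"
  then obtain k where \<phi>: "\<phi> = Const k \<odot>\<^bsub>normal_module I\<^esub> (\<lambda>f\<in>I. residue I (contract b f))" by blast
  have "\<phi> \<in> carrier (normal_module I)"
    using M.smult_closed[OF _ contract_normal[OF split], of "Const k"] \<phi> by simp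
  moreover have "\<phi> f \<in> residue I ` homogeneous_part (\<lambda>i. a i + - indicator b i)"
    if "f \<in> I \<inter> homogeneous_part a" for a f
  proof -
    have "Const k * contract b f \<in> homogeneous_part (\<lambda>i. a i + - indicator b i)"
      using contract_homogeneous[of f a b] that
      by (auto simp: homogeneous_part_def in_keys_iff lookup_Const_mult)
    with that show ?thesis by (simp add: \<phi> normal_module_smult)
  qed
  ultimately show "\<phi> \<in> normal_component I (\<lambda>i. - indicator b i)"
    by (simp add: normal_component_def)
qed

text \<open>The monomial \<open>x^F\<close> goes to 0, hence so does its multiple \<open>x^(b - F) x^F = x^b x^(F - b)\<close>. But
  this multiple goes to \<open>k x^(F - b)\<close>, and \<open>F - b\<close> is a face.\<close>
lemma normal_component_nonsplit:
  assumes b: "b \<notin> \<Delta>" and F: "F - b \<in> \<Delta>" "\<not> b \<subseteq> F" "F \<notin> \<Delta>"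
  shows "normal_component I (\<lambda>i. - indicator b i) = {\<zero>\<^bsub>normal_module I\<^esub>}"
proof (intro equalityI subsetI)
  fix \<phi> assume \<phi>: "\<phi> \<in> normal_component I (\<lambda>i. - indicator b i)"
  then obtain k where k: "\<phi> = (\<lambda>f\<in>I. residue I (Const k * contract b f))"
    using normal_component_scalar[OF b] by blast
  let ?xF = "Poly_Mapping.single (squarefree_exponent F) 1 :: ('n, 'k) mpoly"
    and ?x = "Poly_Mapping.single (squarefree_exponent (b - F)) 1 :: ('n, 'k) mpoly"
  have xF: "?xF \<in> I" using F(3) by (simp add: monomial_mem keys_squarefree_exponent)
  have "\<phi> ?xF = residue I 0"
    using F(2) xF by (simp add: k contract_monomial_eq_zero keys_squarefree_exponent)
  then have "\<phi> (?x * ?xF) = residue I 0"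
    using \<phi> xF by (simp add: normal_component_def normal_module_carrier residue_module_smult)
  moreover have "squarefree_exponent (b - F) + squarefree_exponent F
      = squarefree_exponent b + squarefree_exponent (F - b)"
    by (rule poly_mapping_eqI) (auto simp: lookup_add lookup_squarefree_exponent)
  then have "contract b (?x * ?xF) = Poly_Mapping.single (squarefree_exponent (F - b)) 1"
    by (simp add: mult_single contract_monomial)
  ultimately have "Const k * Poly_Mapping.single (squarefree_exponent (F - b)) 1 \<in> I"
    using mult_mem[OF xF, of ?x] by (simp add: k residue_eq_iff)
  then have "k = 0"
    using F(1) by (auto simp: Const_def mult_single mem_iff keys_squarefree_exponent split: if_splits)
  then show "\<phi> \<in> {\<zero>\<^bsub>normal_module I\<^esub>}"
    by (simp add: k normal_module_zero Const_def)
next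
  interpret M: Module.module S_ring "normal_module I" by (rule module_normal)
  have "0 \<in> homogeneous_part a" for a :: "'n \<Rightarrow> int" by (simp add: homogeneous_part_def)
  then have "\<zero>\<^bsub>normal_module I\<^esub> \<in> normal_component I (\<lambda>i. - indicator b i)"
    using M.M.zero_closed by (auto simp: normal_component_def normal_module_zero)
  then show "\<phi> \<in> normal_component I (\<lambda>i. - indicator b i)" if "\<phi> \<in> {\<zero>\<^bsub>normal_module I\<^esub>}" for \<phi>
    using that by simp
qed

text \<open>The coefficients at \<open>x^m\<close> differ by the factor \<open>m\<^sub>i + 1\<close>, which is 1 unless \<open>i\<close> is in the support
  of \<open>m\<close>; and then the support is a nonface.\<close>
lemma contract_singleton_eq_derivation:
  assumes "{i} \<notin> \<Delta>"
  shows "(\<lambda>f\<in>I. residue I (contract {i} f)) = derivation_hom I (partial i)"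
proof -
  have "contract {i} f - partial i f \<in> I" for f
    unfolding mem_iff
  proof
    fix m assume "m \<in> Poly_Mapping.keys (contract {i} f - partial i f)"
    then have "i \<in> Poly_Mapping.keys m"
      by (cases "Poly_Mapping.lookup m i")
        (auto simp: in_keys_iff lookup_minus lookup_contract lookup_partial)
    then show "Poly_Mapping.keys m \<notin> \<Delta>" using assms face_mono by blast
  qed
  then show ?thesis
    unfolding derivation_hom_def by (intro restrict_ext) (simp add: residue_eq_iff)
qed

text \<open>If \<open>x^b\<close> has two distinct factors \<open>x\<^sub>i\<close> and \<open>x\<^sub>j\<close>, then each summand of the product rule
  for \<open>d (x^b)\<close> is still divisible by one of them, so \<open>d (x^b)\<close> has no constant term. The contraction
  maps \<open>x^b\<close> to 1, and constant terms are well defined modulo \<open>I\<close> since \<open>{}\<close> is a face.\<close>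
lemma contract_not_derivation:
  assumes b: "b \<notin> \<Delta>" and ij: "i \<in> b" "j \<in> b" "i \<noteq> j"
  shows "(\<lambda>f\<in>I. residue I (contract b f)) \<notin> derivation_hom I ` derivations"
proof
  let ?xb = "Poly_Mapping.single (squarefree_exponent b) 1 :: ('n, 'k) mpoly"
  assume "(\<lambda>f\<in>I. residue I (contract b f)) \<in> derivation_hom I ` derivations"
  then obtain d where d: "d \<in> derivations"
    and eq: "(\<lambda>f\<in>I. residue I (contract b f)) = derivation_hom I d" by blast
  have xb: "?xb \<in> I" using b by (simp add: monomial_mem keys_squarefree_exponent)
  have "contract b ?xb = 1"
    using contract_monomial[of b 0 "1 :: 'k"] by simp
  then have "residue I 1 = residue I (d ?xb)"
    using fun_cong[OF eq, of ?xb] xb by (simp add: derivation_hom_def)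
  then have mem: "1 - d ?xb \<in> I" by (simp add: residue_eq_iff)
  have no_constant: "Poly_Mapping.lookup (Var l * f) 0 = 0" for l and f :: "('n, 'k) mpoly"
  proof -
    have "0 \<notin> Poly_Mapping.keys (Var l * f)"
    proof
      assume "0 \<in> Poly_Mapping.keys (Var l * f)"
      then obtain q where "0 = Poly_Mapping.single l (1::nat) + q"
        by (auto simp: Var_def elim: keys_multE)
      then have "Poly_Mapping.lookup 0 l = Poly_Mapping.lookup (Poly_Mapping.single l (1::nat) + q) l"
        by (rule arg_cong)
      then show False by (simp add: lookup_add)
    qed
    then show ?thesis by (simp add: in_keys_iff)
  qed
  have "?xb = Var i * (Var j * (\<Prod>l\<in>b - {i} - {j}. Var l))"
    using ij by (simp add: prod_Var[symmetric] prod.remove[of b i] prod.remove[of "b - {i}" j])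
  then obtain r where r: "?xb = Var i * (Var j * r)" by blast
  have "d ?xb = Var i * d (Var j * r) + Var j * (r * d (Var i))"
    using d unfolding r derivations_def by (simp add: mult.assoc)
  then have "Poly_Mapping.lookup (1 - d ?xb) 0 = 1"
    by (simp add: lookup_minus lookup_add no_constant)
  then have "0 \<in> Poly_Mapping.keys (1 - d ?xb)" by (simp add: in_keys_iff)
  with mem empty_face show False by (auto simp: mem_iff)
qed

end

theorem proposition3p8:
  fixes \<Delta> :: "'n::finite set set" and b :: "'n set"
  assumes "simplicial_complex UNIV \<Delta>" and "\<Delta> \<noteq> {}" and "b \<notin> \<Delta>"
  shows "has_dimension class_ring
    (T1_component (stanley_reisner_ideal \<Delta> :: ('n, 'k::field) mpoly set) (\<lambda>i. - indicator b i))
    (if complex_iso UNIV \<Delta> ((UNIV - b) \<union> b) (complex_join (deletion \<Delta> b) (simplex_boundary b))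
        \<and> card b > 1
     then 1 else 0)"
proof -
  define I :: "('n, 'k) mpoly set" where "I = stanley_reisner_ideal \<Delta>"
  interpret stanley_reisner \<Delta> I
    by (unfold_locales) (use assms I_def in auto)
  let ?\<psi> = "\<lambda>f\<in>I. residue I (contract b f)"
  show ?thesis
  proof (cases "\<forall>F. F - b \<in> \<Delta> \<longrightarrow> \<not> b \<subseteq> F \<longrightarrow> F \<in> \<Delta>")
    case True
    then have "has_dimension class_ring (T1_component I (\<lambda>i. - indicator b i))
        (if ?\<psi> \<in> derivation_hom I ` derivations then 0 else 1)"
      using assms(3) by (intro T1_component_has_dimension contract_normal normal_component_split) auto
    moreover have "?\<psi> \<in> derivation_hom I ` derivations \<longleftrightarrow> \<not> card b > 1"
    proof
      assume "\<not> card b > 1"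
      moreover have "b \<noteq> {}" using assms(3) empty_face by blast
      then have "card b \<noteq> 0" by simp
      ultimately obtain i where "b = {i}" by (metis card_1_singletonE less_one linorder_neqE_nat)
      then show "?\<psi> \<in> derivation_hom I ` derivations"
        using contract_singleton_eq_derivation assms(3) partial_derivation by auto
    next
      assume "?\<psi> \<in> derivation_hom I ` derivations"
      then show "\<not> card b > 1"
        using contract_not_derivation[OF assms(3)] by (metis card_le_Suc0_iff_eq finite_code not_less One_nat_def)
    qed
    ultimately show ?thesis
      using True complex_iso_join_iff[OF assms(1,3)]
      by (cases "card b > 1") (simp_all add: I_def)
  next
    case False
    then obtain F where F: "F - b \<in> \<Delta>" "\<not> b \<subseteq> F" "F \<notin> \<Delta>" by blast
    interpret M: Module.module S_ring "normal_module I" by (rule module_normal)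
    have "Const k \<odot>\<^bsub>normal_module I\<^esub> \<zero>\<^bsub>normal_module I\<^esub> = \<zero>\<^bsub>normal_module I\<^esub>" for k
      using M.smult_r_null by simp
    then have "normal_component I (\<lambda>i. - indicator b i)
        = range (\<lambda>k. Const k \<odot>\<^bsub>normal_module I\<^esub> \<zero>\<^bsub>normal_module I\<^esub>)"
      using normal_component_nonsplit[OF assms(3) F] by auto
    from T1_component_has_dimension[OF M.M.zero_closed this]
    have "has_dimension class_ring (T1_component I (\<lambda>i. - indicator b i)) 0"
      using subgroup.one_closed[OF Module.submodule.axioms(1)[OF submodule_derivations]] by simp
    then show ?thesis
      using False complex_iso_join_iff[OF assms(1,3)] by (auto simp: I_def)
  qed
qed

end
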